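(* Let $m$ be an odd positive integer, let $\beta\in\mathbb{F}_{2^m}^*$, and let $(\mathbb{F}_{2^m},+,\diamond)$ be the Knuth pre-semifield, with multiplication $x\diamond y=xy+x^2\,\mathrm{tr}(\beta y)+y^2\,\mathrm{tr}(\beta x)$. Then for all $x,y\in\mathbb{F}_{2^m}$, $$\diamond\frac{y}{x}=(1+\mathrm{tr}(\beta x))\frac{y}{x}+x\,\mathrm{tr}\left(\beta\frac{y}{x}\right)+x\,\mathrm{tr}(\beta x)\,C_{\frac{1}{\beta x}}\left(\frac{y}{x^2}\right).$$
   Context: $\mathrm{tr}(x)=\sum_{i=0}^{m-1}x^{2^i}$ is the trace from $\mathbb{F}_{2^m}$ to $\mathbb{F}_2$. Division: for $x\in\mathbb{F}_{2^m}^*$ and $y\in\mathbb{F}_{2^m}$, $\diamond\frac{y}{x}$ denotes the unique $a\in\mathbb{F}_{2^m}$ with $y=a\diamond x$ (existence and uniqueness hold because $(\mathbb{F}_{2^m},+,\diamond)$, with the field addition, is known to be a pre-semifield, so right multiplication by a nonzero element is a bijection); moreover $\diamond\frac{y}{0}=0$ for all $y$. For $c\in\mathbb{F}_{2^m}$ and $i_1,\dots,i_s\in\{0,1,\dots,m-1\}$ write $c\langle i_1,\dots,i_s\rangle=\sum_{j=1}^s c^{2^{i_j}}$ (an empty list gives $0$). For $a\in\mathbb{F}_{2^m}^*$, $C_a(z)=\sum_{i=0}^{m-1}c_iz^{2^i}$, where $c_0=\frac1a\langle 1,3,5,\dots,m-2\rangle$, and for $1\le i\le m-1$: $c_i=1+\frac1a\langle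 1,3,5,\dots,i-2,\;i+1,i+3,\dots,m-1\rangle$ if $i$ is odd, and $c_i=\frac1a\langle 0,2,4,\dots,i-2,\;i+1,i+3,\dots,m-2\rangle$ if $i$ is even. (In each list the entries increase in steps of $2$ within each of the two blocks, and a block whose first entry exceeds its last is empty.) Convention: a quotient with zero denominator is interpreted as $0$; in particular for $x=0$ every term of the formula is $0$ (the last term because of the factor $x$). *)

theory Defs
  imports "HOL-Library.Cardinality"
begin

text \<open>The field of order \<open>2 ^ m\<close> is rendered as a type of class \<open>{field, finite}\<close> with
  \<open>2 ^ m\<close> elements. The division of the class \<open>field\<close> already satisfies \<open>x / 0 = 0\<close>.\<close>

text \<open>The trace to the prime field, with values regarded as elements of the big field.\<close>

definition tr :: "nat \<Rightarrow> 'a::field \<Rightarrow> 'a" where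
  "tr m x = (\<Sum>i<m. x ^ (2 ^ i))"

definition knuth_mult :: "nat \<Rightarrow> 'a::field \<Rightarrow> 'a \<Rightarrow> 'a \<Rightarrow> 'a" where
  "knuth_mult m \<beta> x y = x * y + x\<^sup>2 * tr m (\<beta> * y) + y\<^sup>2 * tr m (\<beta> * x)"

text \<open>\<open>psf_divide mul y x\<close> is the quotient of \<open>y\<close> by \<open>x\<close> for the pre-semifield multiplication
  \<open>mul\<close>: the divisor \<open>x\<close> is the right-hand factor.\<close>

definition psf_divide :: "('a \<Rightarrow> 'a \<Rightarrow> 'a) \<Rightarrow> 'a \<Rightarrow> 'a \<Rightarrow> 'a::zero" where
  "psf_divide mul y x = (if x = 0 then 0 else (THE a. y = mul a x))"

definition angle :: "'a::field \<Rightarrow> nat list \<Rightarrow> 'a" where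
  "angle c is = (\<Sum>j\<leftarrow>is. c ^ (2 ^ j))"

text \<open>The list \<open>l, l + 2, l + 4, \<dots>\<close> of entries strictly below \<open>u\<close>. The upper bound is exclusive,
  so that a block with last entry \<open>i - 2\<close> is \<open>steps2 l (i - 1)\<close>; this avoids the truncated
  subtraction \<open>1 - 2\<close>, and blocks whose first entry exceeds the last one are empty.\<close>

definition steps2 :: "nat \<Rightarrow> nat \<Rightarrow> nat list" where
  "steps2 l u = filter (\<lambda>j. even (j - l)) [l..<u]"

definition C_coeff :: "nat \<Rightarrow> 'a::field \<Rightarrow> nat \<Rightarrow> 'a" where
  "C_coeff m a i =
     (if i = 0 then angle (1 / a) (steps2 1 (m - 1))
      else if odd i then 1 + angle (1 / a) (steps2 1 (i - 1) @ steps2 (i + 1) m)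
      else angle (1 / a) (steps2 0 (i - 1) @ steps2 (i + 1) (m - 1)))"

definition C_poly :: "nat \<Rightarrow> 'a::field \<Rightarrow> 'a \<Rightarrow> 'a" where
  "C_poly m a z = (\<Sum>i<m. C_coeff m a i * z ^ (2 ^ i))"

end

(* For x \<noteq> 0 the claimed quotient is a left inverse of a \<mapsto> a \<diamond> x, which is then injective, hence
   bijective, on the finite field. The case tr(\<beta>x) = 0 is immediate. If tr(\<beta>x) = 1, put c = \<beta>x,
   a = xb and z = (a \<diamond> x)/x^2 = b^2 + b + tr(cb). The sum tr(cz) + C(z) is the linearized polynomial
   L(z) with coefficients d_i = \<Sum> c^(2^j) over the even j \<le> i and the odd j > i. Since
   d_i + d_(i-1) = c^(2^i) for i \<ge> 1 and d_0 + d_(m-1) = c + 1, summation by parts gives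
   L(b^2 + b) = tr(cb) + b, and L maps the prime field element tr(cb) to itself because
   \<Sum> d_i = tr(c) = 1. *)

theory Submission
  imports Defs
begin

text \<open>Multiplication by \<open>x \<noteq> 0\<close> permutes the nonzero elements, so their
  product absorbs a factor \<open>x ^ (CARD('a) - 1)\<close>.\<close>

lemma field_power_card_eq_same:
  fixes x :: "'a::{field,finite}"
  shows "x ^ CARD('a) = x"
proof (cases "x = 0")
  case False
  have "bij_betw (\<lambda>y. x * y) (UNIV - {0}) (UNIV - {0})"
    by (rule bij_betw_byWitness[where f' = "\<lambda>y. y / x"]) (use False in auto)
  then have "(\<Prod>y\<in>UNIV - {0}. x * y) = \<Prod>(UNIV - {0})"
    by (rule prod.reindex_bij_betw)
  then have "x ^ (CARD('a) - 1) * \<Prod>(UNIV - {0}) = \<Prod>(UNIV - {0})"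
    by (simp add: prod.distrib card_Diff_singleton)
  moreover have "\<Prod>(UNIV - {0 :: 'a}) \<noteq> 0"
    by simp
  ultimately have "x ^ (CARD('a) - 1) = 1"
    by (metis mult_cancel_right1)
  moreover have "x ^ CARD('a) = x ^ (CARD('a) - 1) * x"
    by (rule power_minus_mult[symmetric]) simp
  ultimately show ?thesis
    by simp
qed simp

locale binary_field =
  fixes m :: nat and ty :: "'a::{field,finite} itself"
  assumes odd_m: "odd m" and card: "CARD('a) = 2 ^ m"
begin

lemma power_two_power_m [simp]: "x ^ 2 ^ m = x" for x :: 'a
  using field_power_card_eq_same[of x] card by simp

lemma add_self [simp]: "x + x = 0" for x :: 'a
proof -
  \<comment> \<open>Characteristic 2 comes from -1 being its own power with the even exponent
    \<open>2 ^ m\<close>.\<close>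
  have "even ((2::nat) ^ m)"
    using odd_m by (auto elim: oddE)
  then have "(1 :: 'a) = - 1"
    using power_two_power_m[of "- 1"] by (metis power_minus_even power_one)
  then have "(1 :: 'a) + 1 = 0"
    by (metis add.right_inverse)
  then have "x * (1 + 1) = 0"
    by (metis mult_zero_right)
  then show ?thesis
    by (simp add: algebra_simps)
qed

lemma add_self_left [simp]: "x + (x + y) = y" for x y :: 'a
  by (metis add.assoc add_self add_0)

lemma power_two_power_add: "(x + y) ^ 2 ^ n = x ^ 2 ^ n + y ^ 2 ^ n" for x y :: 'a
proof (induction n)
  case (Suc n)
  have "(u + v)\<^sup>2 = u\<^sup>2 + v\<^sup>2" for u v :: 'a
    by (simp add: power2_eq_square algebra_simps)
  then show ?case
    by (simp only: power_Suc2 power_mult Suc.IH)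
qed simp

lemma tr_add: "tr m (x + y) = tr m x + tr m y" for x y :: 'a
  by (simp add: tr_def power_two_power_add sum.distrib)

text \<open>Squaring shifts the conjugates of \<open>x\<close> cyclically: the last one wraps around
  to \<open>x\<close>.\<close>

lemma tr_square: "(tr m x)\<^sup>2 = tr m x" for x :: 'a
proof -
  obtain n where m: "m = Suc n"
    using odd_m by (cases m) auto
  have "(\<Sum>i\<in>A. f i)\<^sup>2 = (\<Sum>i\<in>A. (f i)\<^sup>2)" if "finite A" for A and f :: "nat \<Rightarrow> 'a"
    using that by (induction A) (simp_all add: power_two_power_add[of _ _ 1, simplified])
  then have "(tr m x)\<^sup>2 = (\<Sum>i<m. x ^ 2 ^ Suc i)"
    by (simp add: tr_def power_mult power_Suc2 del: power_Suc)
  also have "\<dots> = (\<Sum>i<n. x ^ 2 ^ Suc i) + x"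
    using power_two_power_m[of x] by (simp add: m)
  also have "\<dots> = tr m x"
    unfolding tr_def m sum.lessThan_Suc_shift by (simp add: add.commute)
  finally show ?thesis .
qed

lemma tr_cases: "tr m x = 0 \<or> tr m x = 1" for x :: 'a
  using tr_square[of x] by (auto simp: power2_eq_square)

lemma tr_mult_prime_field:
  fixes t x :: 'a
  assumes "t = 0 \<or> t = 1"
  shows "tr m (x * t) = tr m x * t"
  using assms by (auto simp: tr_def power_0_left)

text \<open>The equivalence selects the even \<open>j \<le> i\<close> and the odd
  \<open>j > i\<close>. Summing over all \<open>j < m\<close> lets coefficients be compared index by
  index.\<close>

definition quot_coeff :: "'a \<Rightarrow> nat \<Rightarrow> 'a" where
  "quot_coeff c i = (\<Sum>j<m. if even j \<longleftrightarrow> j \<le> i then c ^ 2 ^ j else 0)"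

lemma angle_steps2:
  fixes c :: 'a
  assumes "u \<le> m"
  shows "angle c (steps2 l u) = (\<Sum>j<m. if l \<le> j \<and> j < u \<and> even (j - l) then c ^ 2 ^ j else 0)"
proof -
  have "angle c (steps2 l u) = (\<Sum>j\<in>set (steps2 l u). c ^ 2 ^ j)"
    unfolding angle_def steps2_def by (subst sum_list_distinct_conv_sum_set) simp_all
  also have "set (steps2 l u) = {j\<in>{..<m}. l \<le> j \<and> j < u \<and> even (j - l)}"
    using assms by (auto simp: steps2_def)
  also have "(\<Sum>j\<in>\<dots>. c ^ 2 ^ j) = (\<Sum>j<m. if l \<le> j \<and> j < u \<and> even (j - l) then c ^ 2 ^ j else 0)"
    by (rule sum.inter_filter) simp
  finally show ?thesis .
qed

lemma angle_append: "angle c (xs @ ys) = angle c xs + angle c ys" for c :: 'a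
  by (simp add: angle_def)

text \<open>For odd \<open>i\<close> the constant \<open>1\<close> in \<open>c\<^sub>i\<close> is written as \<open>tr m c\<close>, which complements
  the index set.\<close>

lemma C_coeff_eq_quot_coeff:
  fixes c :: 'a
  assumes "tr m c = 1" and "i < m"
  shows "c ^ 2 ^ i + C_coeff m (1 / c) i = quot_coeff c i"
proof -
  \<comment> \<open>With every summand spread over \<open>j < m\<close>, only a parity check per
    index remains. As \<open>m - 1\<close> is even, blocks cut off at \<open>m - 1\<close> still
    contain every odd index below \<open>m\<close>.\<close>
  have single: "c ^ 2 ^ i = (\<Sum>j<m. if j = i then c ^ 2 ^ j else 0)"
    using assms(2) by simp
  have steps: "m - 1 \<le> m" "i - 1 \<le> m"
    using assms(2) by auto
  consider "i = 0" | "odd i" | "i \<noteq> 0" "even i"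
    by blast
  then show ?thesis
  proof cases
    case 1
    then have C: "C_coeff m (1 / c) i = angle c (steps2 1 (m - 1))"
      by (simp add: C_coeff_def)
    show ?thesis
      unfolding single C quot_coeff_def angle_steps2[OF steps(1)] sum.distrib[symmetric]
      by (intro sum.cong) (use 1 odd_m in \<open>auto elim!: oddE\<close>)
  next
    case 2
    then have C: "C_coeff m (1 / c) i
        = tr m c + (angle c (steps2 1 (i - 1)) + angle c (steps2 (i + 1) m))"
      by (auto simp: C_coeff_def angle_append assms(1))
    show ?thesis
      unfolding C single tr_def quot_coeff_def angle_steps2[OF steps(2)] angle_steps2[OF order.refl]
        sum.distrib[symmetric]
      by (intro sum.cong) (use 2 in \<open>auto elim!: oddE\<close>)
  next
    case 3
    then have C: "C_coeff m (1 / c) i = angle c (steps2 0 (i - 1)) + angle c (steps2 (i + 1) (m - 1))"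
      by (simp add: C_coeff_def angle_append)
    show ?thesis
      unfolding single C quot_coeff_def angle_steps2[OF steps(1)] angle_steps2[OF steps(2)]
        sum.distrib[symmetric]
      by (intro sum.cong) (use 3 odd_m in \<open>auto elim!: oddE, presburger+\<close>)
  qed
qed

text \<open>The trace supplies the terms \<open>c ^ 2 ^ i\<close> that make the coefficients uniform
  in \<open>i\<close>.\<close>

lemma tr_add_C_poly:
  fixes c z :: 'a
  assumes "tr m c = 1"
  shows "tr m (c * z) + C_poly m (1 / c) z = (\<Sum>i<m. quot_coeff c i * z ^ 2 ^ i)"
  unfolding tr_def C_poly_def sum.distrib[symmetric]
  by (intro sum.cong)
    (simp_all add: power_mult_distrib C_coeff_eq_quot_coeff[OF assms, symmetric] algebra_simps)

text \<open>The power \<open>c ^ 2 ^ j\<close> occurs in \<open>m - j\<close> coefficients for even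
  \<open>j\<close> and in \<open>j\<close> of them for odd \<open>j\<close>; both counts are
  odd.\<close>

lemma sum_quot_coeff: "(\<Sum>i<m. quot_coeff c i) = tr m c"
proof -
  have parity: "of_nat n = (if even n then 0 else 1 :: 'a)" for n
    by (induction n) auto
  have "(\<Sum>i<m. if even j \<longleftrightarrow> j \<le> i then c ^ 2 ^ j else 0) = c ^ 2 ^ j" if "j < m" for j
  proof -
    have "{i\<in>{..<m}. even j \<longleftrightarrow> j \<le> i} = (if even j then {j..<m} else {..<j})"
      using that by auto
    moreover have "odd (card (if even j then {j..<m} else {..<j}))"
      using odd_m that by auto
    ultimately show ?thesis
      by (simp add: parity flip: sum.inter_filter)
  qed
  then show ?thesis
    unfolding quot_coeff_def tr_def by (subst sum.swap) simp
qed

text \<open>Only the index \<open>Suc i\<close> changes status: it enters if even and leaves if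
  odd.\<close>

lemma quot_coeff_Suc:
  assumes "Suc i < m"
  shows "quot_coeff c (Suc i) + quot_coeff c i = c ^ 2 ^ Suc i"
proof -
  have "quot_coeff c (Suc i) + quot_coeff c i = (\<Sum>j<m. if j = Suc i then c ^ 2 ^ j else 0)"
    unfolding quot_coeff_def sum.distrib[symmetric]
    by (intro sum.cong) (auto simp: le_Suc_eq)
  then show ?thesis
    using assms by simp
qed

text \<open>The first coefficient selects 0 and all odd indices, the last one all even indices, so
  only 0 is counted twice.\<close>

lemma quot_coeff_0_last: "quot_coeff c 0 + quot_coeff c (m - 1) = c + tr m c"
proof -
  have "0 < m"
    using odd_m by (auto elim: oddE)
  have "c = (\<Sum>j<m. if j = 0 then c ^ 2 ^ j else 0)"
    using \<open>0 < m\<close> by simp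
  then have "c + tr m c = (\<Sum>j<m. (if j = 0 then c ^ 2 ^ j else 0) + c ^ 2 ^ j)"
    by (simp only: tr_def sum.distrib)
  also have "\<dots> = quot_coeff c 0 + quot_coeff c (m - 1)"
    unfolding quot_coeff_def sum.distrib[symmetric]
    by (intro sum.cong) auto
  finally show ?thesis
    by simp
qed

lemma quot_poly_left_inverse:
  fixes b c :: 'a
  assumes "tr m c = 1"
  shows "(\<Sum>i<m. quot_coeff c i * (b\<^sup>2 + b + tr m (c * b)) ^ 2 ^ i) = b"
proof -
  let ?d = "quot_coeff c" and ?t = "tr m (c * b)"
  obtain n where m: "m = Suc n"
    using odd_m by (cases m) auto
  have t: "?t ^ 2 ^ i = ?t" for i
    using tr_cases[of "c * b"] by (auto simp: power_0_left)
  have b: "(b\<^sup>2) ^ 2 ^ i = b ^ 2 ^ Suc i" for i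
    by (simp flip: power_mult)
  have bm: "b ^ 2 ^ Suc n = b"
    using power_two_power_m[of b] m by simp
  have "(\<Sum>i<m. ?d i * (b\<^sup>2 + b + ?t) ^ 2 ^ i)
      = (\<Sum>i<m. ?d i * b ^ 2 ^ Suc i) + (\<Sum>i<m. ?d i * b ^ 2 ^ i) + (\<Sum>i<m. ?d i) * ?t"
    by (simp only: power_two_power_add t b distrib_left sum.distrib sum_distrib_right)
  also have "(\<Sum>i<m. ?d i) * ?t = ?t"
    by (simp add: sum_quot_coeff assms)
  \<comment> \<open>The top term wraps around to \<open>b\<close>, so the shifted sum can be matched
    with the unshifted one.\<close>
  also have "(\<Sum>i<m. ?d i * b ^ 2 ^ Suc i) = (\<Sum>i<n. ?d i * b ^ 2 ^ Suc i) + ?d n * b"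
    unfolding m sum.lessThan_Suc bm ..
  also have "(\<Sum>i<m. ?d i * b ^ 2 ^ i) = ?d 0 * b + (\<Sum>i<n. ?d (Suc i) * b ^ 2 ^ Suc i)"
    unfolding m sum.lessThan_Suc_shift by simp
  also have "(\<Sum>i<n. ?d i * b ^ 2 ^ Suc i) + ?d n * b
        + (?d 0 * b + (\<Sum>i<n. ?d (Suc i) * b ^ 2 ^ Suc i))
      = (?d 0 + ?d (m - 1)) * b + (\<Sum>i<n. (?d (Suc i) + ?d i) * b ^ 2 ^ Suc i)"
    by (simp add: m distrib_right sum.distrib add_ac del: power_Suc)
  also have "(\<Sum>i<n. (?d (Suc i) + ?d i) * b ^ 2 ^ Suc i) = (\<Sum>i<n. (c * b) ^ 2 ^ Suc i)"
    by (intro sum.cong refl) (subst quot_coeff_Suc, auto simp: m power_mult_distrib)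
  also have "\<dots> = ?t + c * b"
    unfolding tr_def m sum.lessThan_Suc_shift by (simp add: add.commute)
  \<comment> \<open>The factor of \<open>b\<close> is now \<open>c + 1\<close>; the two copies of
    \<open>c * b\<close> and of the trace cancel.\<close>
  finally show ?thesis
    unfolding quot_coeff_0_last assms by (simp add: algebra_simps)
qed

definition knuth_quotient :: "'a \<Rightarrow> 'a \<Rightarrow> 'a \<Rightarrow> 'a" where
  "knuth_quotient \<beta> y x =
     (1 + tr m (\<beta> * x)) * (y / x) + x * tr m (\<beta> * (y / x))
     + x * tr m (\<beta> * x) * C_poly m (1 / (\<beta> * x)) (y / x\<^sup>2)"

lemma knuth_quotient_mult:
  assumes "x \<noteq> 0"
  shows "knuth_quotient \<beta> (knuth_mult m \<beta> a x) x = a"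
  using tr_cases[of "\<beta> * x"]
proof
  assume 0: "tr m (\<beta> * x) = 0"
  let ?t = "tr m (\<beta> * a)"
  have "knuth_mult m \<beta> a x / x = a + x * ?t"
    using assms by (simp add: knuth_mult_def 0 power2_eq_square add_divide_distrib)
  \<comment> \<open>The trace \<open>?t\<close> is a prime field scalar, so the extra term
    contributes \<open>tr m (\<beta> * x) * ?t = 0\<close>.\<close>
  moreover have "tr m (\<beta> * (a + x * ?t)) = ?t"
    using tr_mult_prime_field[OF tr_cases, of "\<beta> * x" "\<beta> * a"]
    by (simp add: distrib_left tr_add 0 mult.assoc)
  ultimately show ?thesis
    by (simp add: knuth_quotient_def 0 add.assoc)
next
  assume 1: "tr m (\<beta> * x) = 1"
  define b where "b = a / x"
  define z where "z = b\<^sup>2 + b + tr m (\<beta> * x * b)"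
  have a: "a = x * b"
    using assms by (simp add: b_def)
  have y: "knuth_mult m \<beta> a x = x\<^sup>2 * z"
    by (simp add: knuth_mult_def 1 a z_def power2_eq_square algebra_simps)
  \<comment> \<open>The first summand vanishes because 1 + 1 = 0, and the quotient by
    \<open>x\<close> is \<open>x * z\<close>.\<close>
  have "knuth_quotient \<beta> (knuth_mult m \<beta> a x) x
      = x * (tr m (\<beta> * x * z) + C_poly m (1 / (\<beta> * x)) z)"
    unfolding y knuth_quotient_def using assms
    by (simp add: 1 power2_eq_square distrib_left mult.assoc)
  also have "\<dots> = a"
    unfolding tr_add_C_poly[OF 1] z_def quot_poly_left_inverse[OF 1] a ..
  finally show ?thesis .
qed

lemma psf_divide_knuth_mult: "psf_divide (knuth_mult m \<beta>) y x = knuth_quotient \<beta> y x"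
proof (cases "x = 0")
  case True
  \<comment> \<open>For divisor 0 both sides are 0 by the conventions for division.\<close>
  then show ?thesis
    by (simp add: psf_divide_def knuth_quotient_def)
next
  case False
  have "inj (\<lambda>a. knuth_mult m \<beta> a x)"
    by (rule inj_on_inverseI) (rule knuth_quotient_mult[OF False])
  then have "surj (\<lambda>a. knuth_mult m \<beta> a x)"
    by (rule finite_UNIV_inj_surj[OF finite])
  then obtain a where a: "y = knuth_mult m \<beta> a x"
    by blast
  then have "(THE a. y = knuth_mult m \<beta> a x) = a"
    by (intro the_equality) (metis knuth_quotient_mult[OF False])+
  then show ?thesis
    using False by (simp add: psf_divide_def a knuth_quotient_mult)
qed

end

theorem theorem4p4:
  fixes m :: nat and \<beta> x y :: "'a::{field,finite}"
  assumes "odd m" and "CARD('a) = 2 ^ m" and "\<beta> \<noteq> 0"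
  shows "psf_divide (knuth_mult m \<beta>) y x =
           (1 + tr m (\<beta> * x)) * (y / x) + x * tr m (\<beta> * (y / x))
           + x * tr m (\<beta> * x) * C_poly m (1 / (\<beta> * x)) (y / x\<^sup>2)"
proof -
  interpret binary_field m "TYPE('a)"
    using assms by unfold_locales
  show ?thesis
    by (simp add: psf_divide_knuth_mult knuth_quotient_def)
qed

end
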